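(* Let $N\ge1$, let $n_1,\dots,n_N\ge1$ be integers and let $f_1,\dots,f_N\in C([0,1])$. Then, as $n\to\infty$, $$\mathbb{E}\left[:\varphi_n^{n_1}(f_1):\cdots:\varphi_n^{n_N}(f_N):\right]\longrightarrow \mathbb{E}\left[:(f_1,\xi)^{n_1}:\cdots:(f_N,\xi)^{n_N}:\right].$$
   Context: Bernoulli noise: $(\varepsilon_k)_{k\ge1}$ are independent random variables with $P(\varepsilon_k=1)=P(\varepsilon_k=-1)=\frac12$; for $n\ge1$ and $f\in C([0,1])$, $\varphi_n(f):=\sum_{k=1}^n f\left(\frac kn\right)\frac{\varepsilon_k}{\sqrt n}$. Gaussian white noise $\xi$ on $L_2([0,1])$: a family of jointly Gaussian centered random variables $(g,\xi)$, $g\in L_2([0,1])$, with $\mathbb{E}(g,\xi)(h,\xi)=\int_0^1 g(s)h(s)\,ds$. Wick powers: for a random variable $\eta$ with finite moments, $:\eta^m:\;=P_m(\eta)$, where $P_m$ is the polynomial of degree $m$ determined by $P_0(x)=1$, $P_m'(x)=mP_{m-1}(x)$ and $\mathbb{E}P_m(\eta)=0$ for $m\ge1$. $:\varphi_n^{m}(f):$ is the $m$-th Wick power of $\eta=\varphi_n(f)$, and $:(f,\xi)^m:$ that of $\eta=(f,\xi)$. *)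

theory Defs
  imports "HOL-Probability.Probability" "HOL-Computational_Algebra.Polynomial"
begin

subsection \<open>Wick powers\<close>

definition is_wick_sequence :: "'a measure \<Rightarrow> ('a \<Rightarrow> real) \<Rightarrow> (nat \<Rightarrow> real poly) \<Rightarrow> bool" where
  "is_wick_sequence M \<eta> P \<longleftrightarrow>
     P 0 = 1 \<and>
     (\<forall>m\<ge>1. pderiv (P m) = smult (of_nat m) (P (m - 1))) \<and>
     (\<forall>m\<ge>1. (\<integral>\<omega>. poly (P m) (\<eta> \<omega>) \<partial>M) = 0)"

definition wick_poly :: "'a measure \<Rightarrow> ('a \<Rightarrow> real) \<Rightarrow> nat \<Rightarrow> real poly" where
  "wick_poly M \<eta> = (THE P. is_wick_sequence M \<eta> P)"

definition wick_power :: "'a measure \<Rightarrow> ('a \<Rightarrow> real) \<Rightarrow> nat \<Rightarrow> 'a \<Rightarrow> real" where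
  "wick_power M \<eta> m \<omega> = poly (wick_poly M \<eta> m) (\<eta> \<omega>)"

text \<open>The definite description above is justified: for a random variable with finite moments
  there is exactly one such sequence of polynomials.\<close>

lemma ex_pderiv_eq: "\<exists>q. pderiv q = (p :: real poly)"
proof
  show "pderiv (\<Sum>i\<le>degree p. monom (coeff p i / real (Suc i)) (Suc i)) = p"
    using poly_as_sum_of_monoms[of p]
    by (simp add: sum_comp_morphism[of pderiv, symmetric] pderiv_add o_def pderiv_monom
        del: of_nat_Suc)
qed

lemma integrable_poly:
  assumes "\<And>k. integrable M (\<lambda>\<omega>. (\<eta> \<omega> :: real) ^ k)"
  shows "integrable M (\<lambda>\<omega>. poly p (\<eta> \<omega>))"
  unfolding poly_altdef using assms by auto

lemma ex1_wick_sequence: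
  assumes "prob_space M" and mom: "\<And>k. integrable M (\<lambda>\<omega>. \<eta> \<omega> ^ k)"
  shows "\<exists>!P. is_wick_sequence M \<eta> P"
proof -
  interpret prob_space M by fact
  note int = integrable_poly[OF mom]
  have step: "\<exists>q. pderiv q = p \<and> (\<integral>\<omega>. poly q (\<eta> \<omega>) \<partial>M) = 0" for p
  proof -
    obtain q where q: "pderiv q = p" using ex_pderiv_eq by blast
    define c where "c = (\<integral>\<omega>. poly q (\<eta> \<omega>) \<partial>M)"
    have "pderiv (q - [:c:]) = p" using q by (simp add: pderiv_diff)
    moreover have "(\<integral>\<omega>. poly (q - [:c:]) (\<eta> \<omega>) \<partial>M) = 0"
      using int[of q] by (simp add: c_def prob_space)
    ultimately show ?thesis by blast
  qed
  define nxt where "nxt p = (SOME q. pderiv q = p \<and> (\<integral>\<omega>. poly q (\<eta> \<omega>) \<partial>M) = 0)" for p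
  have nxt: "pderiv (nxt p) = p" "(\<integral>\<omega>. poly (nxt p) (\<eta> \<omega>) \<partial>M) = 0" for p
    using someI_ex[OF step[of p]] by (auto simp: nxt_def)
  define P where "P = rec_nat 1 (\<lambda>m p. nxt (smult (of_nat (Suc m)) p))"
  have P0: "P 0 = 1" and PS: "P (Suc m) = nxt (smult (of_nat (Suc m)) (P m))" for m
    by (auto simp: P_def)
  have "is_wick_sequence M \<eta> P"
    unfolding is_wick_sequence_def
  proof (intro conjI allI impI)
    show "P 0 = 1" by (rule P0)
    fix m :: nat assume "m \<ge> 1"
    then obtain k where k: "m = Suc k" by (cases m) auto
    show "pderiv (P m) = smult (of_nat m) (P (m - 1))"
      unfolding k PS nxt by simp
    show "(\<integral>\<omega>. poly (P m) (\<eta> \<omega>) \<partial>M) = 0" unfolding k PS nxt by simp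
  qed
  moreover have "Q = R" if Q: "is_wick_sequence M \<eta> Q" and R: "is_wick_sequence M \<eta> R" for Q R
  proof
    fix m show "Q m = R m"
    proof (induction m)
      case 0
      then show ?case using Q R by (simp add: is_wick_sequence_def)
    next
      case (Suc m)
      have S: "Suc m \<ge> 1" "Suc m - 1 = m" by auto
      have "pderiv (Q (Suc m)) = smult (of_nat (Suc m)) (Q m)"
        "pderiv (R (Suc m)) = smult (of_nat (Suc m)) (R m)"
        using Q R S unfolding is_wick_sequence_def by metis+
      then have "pderiv (Q (Suc m) - R (Suc m)) = 0"
        using Suc by (simp add: pderiv_diff)
      then obtain c where c: "Q (Suc m) - R (Suc m) = [:c:]"
        by (metis pderiv_eq_0_iff degree_eq_zeroE)
      have z: "(\<integral>\<omega>. poly (Q (Suc m)) (\<eta> \<omega>) \<partial>M) = 0" "(\<integral>\<omega>. poly (R (Suc m)) (\<eta> \<omega>) \<partial>M) = 0"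
        using Q R S unfolding is_wick_sequence_def by blast+
      have "c = (\<integral>\<omega>. poly (Q (Suc m) - R (Suc m)) (\<eta> \<omega>) \<partial>M)"
        by (simp only: c) (simp add: prob_space)
      also have "\<dots> = 0" using z int by simp
      finally show ?case using c by simp
    qed
  qed
  ultimately show ?thesis by blast
qed

lemma is_wick_sequence_wick_poly:
  assumes "prob_space M" "\<And>k. integrable M (\<lambda>\<omega>. \<eta> \<omega> ^ k)"
  shows "is_wick_sequence M \<eta> (wick_poly M \<eta>)"
  unfolding wick_poly_def by (rule theI'[OF ex1_wick_sequence[OF assms]])


subsection \<open>Bernoulli noise\<close>

definition bernoulli_noise :: "'a measure \<Rightarrow> (nat \<Rightarrow> 'a \<Rightarrow> real) \<Rightarrow> bool" where
  "bernoulli_noise M \<epsilon> \<longleftrightarrow>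
     prob_space M \<and>
     prob_space.indep_vars M (\<lambda>_. borel) \<epsilon> {1..} \<and>
     (\<forall>k\<ge>1. measure M {\<omega> \<in> space M. \<epsilon> k \<omega> = 1} = 1/2 \<and>
             measure M {\<omega> \<in> space M. \<epsilon> k \<omega> = -1} = 1/2)"

definition bernoulli_pairing :: "(nat \<Rightarrow> 'a \<Rightarrow> real) \<Rightarrow> nat \<Rightarrow> (real \<Rightarrow> real) \<Rightarrow> 'a \<Rightarrow> real" where
  "bernoulli_pairing \<epsilon> n f \<omega> = (\<Sum>k=1..n. f (real k / real n) * (\<epsilon> k \<omega> / sqrt (real n)))"


subsection \<open>Gaussian white noise\<close>

text \<open>Elements of \<open>L\<^sub>2([0,1])\<close> are represented by functions on the real line whose values outside
  \<open>[0,1]\<close> are irrelevant. No quotient by almost-everywhere equality is needed: the covariance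
  condition of white noise below forces \<open>\<xi> g = \<xi> h\<close> almost surely whenever \<open>g = h\<close>
  almost everywhere on \<open>[0,1]\<close>.\<close>

definition L2_unit :: "(real \<Rightarrow> real) set" where
  "L2_unit = {g. g \<in> borel_measurable (lebesgue_on {0..1}) \<and>
                 integrable (lebesgue_on {0..1}) (\<lambda>s. (g s)\<^sup>2)}"

text \<open>Degenerate (almost surely constant) variables count as Gaussian.\<close>

definition gaussian_rv :: "'a measure \<Rightarrow> ('a \<Rightarrow> real) \<Rightarrow> bool" where
  "gaussian_rv M X \<longleftrightarrow>
     X \<in> borel_measurable M \<and>
     ((\<exists>\<mu> \<sigma>. \<sigma> > 0 \<and> distributed M lborel X (\<lambda>x. ennreal (normal_density \<mu> \<sigma> x))) \<or>
      (\<exists>\<mu>. AE \<omega> in M. X \<omega> = \<mu>))"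

definition jointly_gaussian :: "'a measure \<Rightarrow> 'i set \<Rightarrow> ('i \<Rightarrow> 'a \<Rightarrow> real) \<Rightarrow> bool" where
  "jointly_gaussian M I X \<longleftrightarrow>
     (\<forall>J c. finite J \<longrightarrow> J \<subseteq> I \<longrightarrow> gaussian_rv M (\<lambda>\<omega>. \<Sum>j\<in>J. c j * X j \<omega>))"

definition white_noise :: "'a measure \<Rightarrow> ((real \<Rightarrow> real) \<Rightarrow> 'a \<Rightarrow> real) \<Rightarrow> bool" where
  "white_noise M \<xi> \<longleftrightarrow>
     prob_space M \<and>
     jointly_gaussian M L2_unit \<xi> \<and>
     (\<forall>g\<in>L2_unit. (\<integral>\<omega>. \<xi> g \<omega> \<partial>M) = 0) \<and>
     (\<forall>g\<in>L2_unit. \<forall>h\<in>L2_unit.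
        (\<integral>\<omega>. \<xi> g \<omega> * \<xi> h \<omega> \<partial>M) = (\<integral>s. g s * h s \<partial>lebesgue_on {0..1}))"

end

theory Submission
  imports Defs "HOL-Computational_Algebra.Formal_Power_Series"
begin

text \<open>The coefficients of Wick polynomials are continuous functions of the moments of the variable,
  so it is enough to show that the joint moments of \<open>\<phi>\<^sub>n(f\<^sub>i)\<close> converge to those of \<open>(f\<^sub>i, \<xi>)\<close>.
  Polarization, together with linearity in \<open>f\<close>, reduces this to the moments of a single variable. The
  exponential generating series of the moments of \<open>\<Sum>\<^sub>k a\<^sub>k \<epsilon>\<^sub>k\<close> is \<open>G(t) = \<Prod>\<^sub>k cosh(a\<^sub>k t)\<close>, and
  \<open>G' = G \<cdot> \<Sum>\<^sub>k a\<^sub>k tanh(a\<^sub>k t)\<close> expresses its coefficients recursively through the power sums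
  \<open>\<Sum>\<^sub>k a\<^sub>k\<^sup>j\<close>. For \<open>a\<^sub>k = f(k/n) / \<surd>n\<close> the power sum with \<open>j = 2\<close> is a Riemann sum for \<open>\<integral>f\<^sup>2\<close> and
  those with \<open>j \<ge> 3\<close> vanish in the limit, which leaves the recursion of the Gaussian moments.\<close>

section \<open>Polarization of products\<close>

lemma fps_exp_sum:
  fixes x :: "'i \<Rightarrow> 'a::field_char_0"
  shows "finite T \<Longrightarrow> fps_exp (\<Sum>t\<in>T. x t) = (\<Prod>t\<in>T. fps_exp (x t))"
  by (induction T rule: finite_induct) (simp_all add: fps_exp_add_mult)

text \<open>In the product of the series e^(x_t X) - 1 over \<open>S\<close> every factor is
  divisible by X, so its coefficient at degree \<open>card S\<close> is the product of the
  \<open>x t\<close>. Expanding the same product over subsets \<open>T\<close> leaves exponentials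
  of partial sums, whose coefficient at that degree is a power divided by a factorial.\<close>

lemma polarization:
  fixes x :: "'i \<Rightarrow> 'a::field_char_0"
  assumes "finite S"
  shows "(\<Prod>t\<in>S. x t) =
    (\<Sum>T\<in>Pow S. (-1) ^ (card S - card T) / fact (card S) * (\<Sum>t\<in>T. x t) ^ card S)"
proof -
  \<comment> \<open>\<open>h c\<close> is (e^(cX) - 1) / X, whose constant coefficient is
    \<open>c\<close>.\<close>
  define h where "h c = Abs_fps (\<lambda>r. c ^ Suc r / fact (Suc r))" for c :: 'a
  have h: "fps_exp c - 1 = fps_X * h c" for c
  proof (rule fps_ext)
    fix r show "fps_nth (fps_exp c - 1) r = fps_nth (fps_X * h c) r"
      by (cases r) (simp_all add: h_def fps_exp_def)
  qed
  have "(\<Prod>t\<in>S. fps_exp (x t) - 1) =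
      (\<Sum>T\<in>Pow S. (-1) ^ (card S - card T) * fps_exp (\<Sum>t\<in>T. x t))"
    unfolding prod_diff_conv_sum'[OF assms]
    by (intro sum.cong refl) (use finite_subset[OF _ assms] in \<open>auto simp: fps_exp_sum\<close>)
  also have "\<dots> = (\<Sum>T\<in>Pow S. fps_const ((-1) ^ (card S - card T)) * fps_exp (\<Sum>t\<in>T. x t))"
    by (intro sum.cong refl) (simp add: fps_const_power[symmetric] fps_const_neg[symmetric] del: fps_const_power fps_const_neg)
  also have "fps_nth \<dots> (card S) =
      (\<Sum>T\<in>Pow S. (-1) ^ (card S - card T) / fact (card S) * (\<Sum>t\<in>T. x t) ^ card S)"
    by (simp add: fps_sum_nth fps_exp_def)
  finally have "fps_nth (\<Prod>t\<in>S. fps_exp (x t) - 1) (card S) =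
      (\<Sum>T\<in>Pow S. (-1) ^ (card S - card T) / fact (card S) * (\<Sum>t\<in>T. x t) ^ card S)" .
  moreover have "(\<Prod>t\<in>S. fps_exp (x t) - 1) = fps_X ^ card S * (\<Prod>t\<in>S. h (x t))"
    by (simp add: h prod.distrib)
  moreover have "fps_nth (\<Prod>t\<in>S. h (x t)) 0 = (\<Prod>t\<in>S. x t)"
    using assms by (induction S rule: finite_induct) (auto simp: h_def)
  ultimately show ?thesis by (simp add: fps_X_power_mult_nth)
qed

section \<open>Moment series of weighted sign sums and their Gaussian limit\<close>

definition cosh_fps :: "real \<Rightarrow> real fps" where
  "cosh_fps a = Abs_fps (\<lambda>r. if even r then a ^ r / fact r else 0)"

definition tanh_coeff :: "nat \<Rightarrow> real" where
  "tanh_coeff = fps_nth (fps_deriv (cosh_fps 1) * inverse (cosh_fps 1))"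

text \<open>Rescaling t to at reduces the claim to a = 1, where it is the defining relation of
  \<open>tanh_coeff\<close>: coefficient \<open>r\<close> of either side is \<open>a ^ Suc r\<close>
  times its value at a = 1. The first factor on the right is the series of a tanh(at).\<close>

lemma fps_deriv_cosh_fps:
  "fps_deriv (cosh_fps a) = Abs_fps (\<lambda>j. a ^ Suc j * tanh_coeff j) * cosh_fps a"
proof (rule fps_ext)
  fix r
  have "inverse (cosh_fps 1) * cosh_fps 1 = 1"
    by (rule inverse_mult_eq_1) (simp add: cosh_fps_def)
  then have "Abs_fps tanh_coeff * cosh_fps 1 = fps_deriv (cosh_fps 1)"
    by (simp add: tanh_coeff_def fps_nth_inverse mult.assoc)
  then have "(\<Sum>j\<le>r. tanh_coeff j * fps_nth (cosh_fps 1) (r - j)) = fps_nth (fps_deriv (cosh_fps 1)) r"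
    by (metis (no_types, lifting) fps_mult_nth fps_nth_Abs_fps atMost_atLeast0 sum.cong)
  then have *: "a ^ Suc r * (\<Sum>j\<le>r. tanh_coeff j * fps_nth (cosh_fps 1) (r - j)) =
      fps_nth (fps_deriv (cosh_fps a)) r"
    by (simp add: cosh_fps_def)
  have "fps_nth (cosh_fps a) i = a ^ i * fps_nth (cosh_fps 1) i" for i
    by (simp add: cosh_fps_def)
  then have "fps_nth (Abs_fps (\<lambda>j. a ^ Suc j * tanh_coeff j) * cosh_fps a) r =
     (\<Sum>j\<le>r. a ^ Suc j * tanh_coeff j * (a ^ (r - j) * fps_nth (cosh_fps 1) (r - j)))"
    by (simp add: fps_mult_nth atMost_atLeast0)
  also have "\<dots> = a ^ Suc r * (\<Sum>j\<le>r. tanh_coeff j * fps_nth (cosh_fps 1) (r - j))"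
    unfolding sum_distrib_left
  proof (intro sum.cong refl)
    fix j assume "j \<in> {..r}"
    then have "a ^ Suc r = a ^ Suc j * a ^ (r - j)" by (subst power_add[symmetric]) simp
    then show "a ^ Suc j * tanh_coeff j * (a ^ (r - j) * fps_nth (cosh_fps 1) (r - j)) =
        a ^ Suc r * (tanh_coeff j * fps_nth (cosh_fps 1) (r - j))"
      by (simp only: mult_ac)
  qed
  finally show "fps_nth (fps_deriv (cosh_fps a)) r =
      fps_nth (Abs_fps (\<lambda>j. a ^ Suc j * tanh_coeff j) * cosh_fps a) r"
    using * by simp
qed

text \<open>In the recursion below, the first value removes the power sum of order 1 and the second
  keeps that of order 2 with weight 1. All other values only multiply power sums that vanish in the
  limit.\<close>

lemma tanh_coeff_0: "tanh_coeff 0 = 0" and tanh_coeff_1: "tanh_coeff 1 = 1"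
  by (simp_all add: tanh_coeff_def cosh_fps_def fps_mult_nth numeral_2_eq_2)

text \<open>The logarithmic derivative turns the product into a sum to which each factor contributes
  its a tanh(at). Coefficient \<open>r\<close> of the resulting differential equation involves only
  coefficients of lower degree on the right.\<close>

lemma fps_nth_prod_cosh_fps:
  assumes "finite A"
  shows "real (Suc r) * fps_nth (\<Prod>k\<in>A. cosh_fps (a k)) (Suc r) =
    (\<Sum>j\<le>r. tanh_coeff j * (\<Sum>k\<in>A. a k ^ Suc j) * fps_nth (\<Prod>k\<in>A. cosh_fps (a k)) (r - j))"
proof -
  have "fps_deriv (\<Prod>k\<in>A. cosh_fps (a k)) =
      Abs_fps (\<lambda>j. tanh_coeff j * (\<Sum>k\<in>A. a k ^ Suc j)) * (\<Prod>k\<in>A. cosh_fps (a k))"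
    using assms
  proof (induction A rule: finite_induct)
    case (insert k A)
    have "Abs_fps (\<lambda>j. tanh_coeff j * (\<Sum>k\<in>insert k A. a k ^ Suc j)) =
        Abs_fps (\<lambda>j. a k ^ Suc j * tanh_coeff j) + Abs_fps (\<lambda>j. tanh_coeff j * (\<Sum>k\<in>A. a k ^ Suc j))"
      using insert.hyps by (intro fps_ext) (simp add: algebra_simps)
    then show ?case
      using insert by (simp add: fps_deriv_cosh_fps algebra_simps)
  qed (simp add: fps_zero_def[symmetric])
  then have "fps_nth (fps_deriv (\<Prod>k\<in>A. cosh_fps (a k))) r =
      fps_nth (Abs_fps (\<lambda>j. tanh_coeff j * (\<Sum>k\<in>A. a k ^ Suc j)) * (\<Prod>k\<in>A. cosh_fps (a k))) r"
    by simp
  then show ?thesis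
    by (simp add: fps_mult_nth atMost_atLeast0)
qed

text \<open>For \<open>r\<close> = 2b this is (2b - 1)!! v^b, the moment of a centered normal
  variable of variance \<open>v\<close>. Divided by \<open>fact r\<close> it is a coefficient of
  e^(v t^2 / 2), and \<open>v\<close> = 0 gives the moments of the zero variable.\<close>

definition gauss_moment :: "real \<Rightarrow> nat \<Rightarrow> real" where
  "gauss_moment v r = (if even r then fact r * (v / 2) ^ (r div 2) / fact (r div 2) else 0)"

lemma gauss_moment_rec: "gauss_moment v (Suc (Suc r)) = real (Suc r) * v * gauss_moment v r"
proof (cases "even r")
  case True
  then obtain b where "r = 2 * b" by (elim evenE)
  then show ?thesis
    by (simp add: gauss_moment_def field_simps del: of_nat_Suc)
      (simp add: algebra_simps)
qed (simp add: gauss_moment_def)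

text \<open>Strong induction passes to the limit in each summand of
  \<open>fps_nth_prod_cosh_fps\<close>. Only the summand \<open>j = 1\<close> can survive, and what
  remains is \<open>gauss_moment_rec\<close> divided by factorials. This is a central limit theorem
  for moments of a triangular array.\<close>

lemma fps_nth_prod_cosh_fps_tendsto:
  assumes fin: "\<And>n. finite (A n)"
    and var: "(\<lambda>n. \<Sum>k\<in>A n. (a n k)\<^sup>2) \<longlonglongrightarrow> v"
    and higher: "\<And>j. j \<ge> 3 \<Longrightarrow> (\<lambda>n. \<Sum>k\<in>A n. a n k ^ j) \<longlonglongrightarrow> 0"
  shows "(\<lambda>n. fps_nth (\<Prod>k\<in>A n. cosh_fps (a n k)) r) \<longlonglongrightarrow> gauss_moment v r / fact r"
proof (induction r rule: less_induct)
  case (less r)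
  define G where "G n = (\<Prod>k\<in>A n. cosh_fps (a n k))" for n
  show ?case
  proof (cases r)
    case 0
    have "fps_nth (G n) 0 = 1" for n
      unfolding G_def using fin[of n]
      by (induction rule: finite_induct) (simp_all add: cosh_fps_def)
    then show ?thesis using 0 by (simp add: gauss_moment_def flip: G_def)
  next
    case (Suc q)
    \<comment> \<open>\<open>L j\<close> is the limit of summand \<open>j\<close>. At
      \<open>q = 0\<close> the truncated \<open>q - 1\<close> still equals \<open>q - j\<close> for
      \<open>j = 1\<close>, an index that the sum over \<open>{..q}\<close> then misses.\<close>
    define L where "L j = (if j = 1 then v * (gauss_moment v (q - 1) / fact (q - 1)) else 0)" for j :: nat
    have "(\<lambda>n. tanh_coeff j * (\<Sum>k\<in>A n. a n k ^ Suc j) * fps_nth (G n) (q - j)) \<longlonglongrightarrow> L j" for j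
    proof -
      have IH: "(\<lambda>n. fps_nth (G n) (q - j)) \<longlonglongrightarrow> gauss_moment v (q - j) / fact (q - j)"
        unfolding G_def using Suc by (intro less) auto
      consider "j = 0" | "j = 1" | "Suc j \<ge> 3" by linarith
      then show ?thesis
      proof cases
        case 2
        then show ?thesis
          using tendsto_mult[OF var IH] by (simp add: tanh_coeff_1[simplified] L_def numeral_2_eq_2)
      next
        case 3
        then show ?thesis
          using tendsto_mult[OF tendsto_mult[OF tendsto_const higher[OF 3]] IH] by (simp add: L_def)
      qed (simp add: tanh_coeff_0 L_def)
    qed
    then have "(\<lambda>n. (\<Sum>j\<le>q. tanh_coeff j * (\<Sum>k\<in>A n. a n k ^ Suc j) * fps_nth (G n) (q - j)) / real (Suc q))
        \<longlonglongrightarrow> (\<Sum>j\<le>q. L j) / real (Suc q)"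
      by (intro tendsto_intros) auto
    moreover have "(\<Sum>j\<le>q. tanh_coeff j * (\<Sum>k\<in>A n. a n k ^ Suc j) * fps_nth (G n) (q - j)) / real (Suc q)
        = fps_nth (G n) r" for n
      using fps_nth_prod_cosh_fps[OF fin[of n], of q "a n"] unfolding G_def Suc
      by (metis nonzero_mult_div_cancel_left of_nat_0_eq_iff nat.distinct(1))
    moreover have "(\<Sum>j\<le>q. L j) / real (Suc q) = gauss_moment v r / fact r"
    proof (cases q)
      case 0
      then show ?thesis by (simp add: Suc L_def gauss_moment_def)
    next
      case (Suc p)
      have sum_L: "(\<Sum>j\<le>q. L j) = v * (gauss_moment v p / fact p)"
        unfolding L_def using Suc by (subst sum.delta) auto
      have "gauss_moment v r / fact r =
          real (Suc p) * v * gauss_moment v p / (real (Suc q) * (real (Suc p) * fact p))"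
        unfolding \<open>r = Suc q\<close> Suc gauss_moment_rec fact_Suc by simp
      then show ?thesis by (simp add: sum_L del: of_nat_Suc)
    qed
    ultimately show ?thesis by (simp add: G_def)
  qed
qed

section \<open>Convergence of Riemann sums\<close>

lemma riemann_sum_tendsto:
  fixes h :: "real \<Rightarrow> real"
  assumes cont: "continuous_on {0..1} h"
  shows "(\<lambda>n. (\<Sum>k=1..n. h (real k / real n)) / real n) \<longlonglongrightarrow> (\<integral>s. h s \<partial>lebesgue_on {0..1})"
proof -
  \<comment> \<open>The antiderivative \<open>F\<close> turns the integral into a telescoping sum
    over cells, each of which is compared with one term of the Riemann sum.\<close>
  define F where "F x = integral {0..x} h" for x
  have F1: "(\<integral>s. h s \<partial>lebesgue_on {0..1}) = F 1 - F 0"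
    unfolding F_def
    using lebesgue_integral_eq_integral[OF continuous_imp_integrable_real[OF cont]] by simp
  have ucont: "uniformly_continuous_on {0..1} h"
    by (rule compact_uniformly_continuous[OF cont]) simp
  show ?thesis
  proof (rule LIMSEQ_I)
    fix e :: real assume e: "e > 0"
    then obtain d where d: "d > 0"
      "\<And>x y. x \<in> {0..1} \<Longrightarrow> y \<in> {0..1} \<Longrightarrow> dist y x < d \<Longrightarrow> dist (h y) (h x) < e / 2"
      using ucont unfolding uniformly_continuous_on_def by (meson half_gt_zero)
    obtain n0 :: nat where n0: "1 / d < real n0" using reals_Archimedean2 by blast
    show "\<exists>no. \<forall>n\<ge>no. norm ((\<Sum>k=1..n. h (real k / real n)) / real n - (\<integral>s. h s \<partial>lebesgue_on {0..1})) < e"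
    proof (intro exI allI impI)
      \<comment> \<open>\<open>Suc n0\<close> makes \<open>n\<close> positive, and \<open>n\<close>
        above 1/d puts the mesh 1/n below \<open>d\<close>.\<close>
      fix n assume n: "n \<ge> Suc n0"
      then have npos: "real n > 0" by simp
      have "1 / d < real n" using n n0 by linarith
      then have nd: "1 / real n < d" using d(1) npos by (simp add: field_simps)
      have step: "\<bar>h (real k / real n) / real n - (F (real k / real n) - F (real (k - 1) / real n))\<bar>
          \<le> e / 2 / real n" if k: "k \<in> {1..n}" for k
      proof -
        define a b where "a = real (k - 1) / real n" and "b = real k / real n"
        have ab: "0 \<le> a" "a < b" "b \<le> 1" and ba: "b - a = 1 / real n"
          using k npos by (auto simp: a_def b_def field_simps of_nat_diff)
        have der: "(F has_real_derivative h x) (at x within {a..b})" if "a \<le> x" "x \<le> b" for x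
        proof (rule DERIV_subset)
          show "(F has_real_derivative h x) (at x within {0..1})"
            unfolding F_def using that ab by (intro integral_has_real_derivative cont) auto
        qed (use ab in auto)
        \<comment> \<open>The mean value theorem writes the increment of \<open>F\<close> as
          \<open>h x\<close> times the mesh. Since \<open>x\<close> lies within \<open>d\<close> of
          the sampled endpoint \<open>b\<close>, each cell has error at most
          \<open>e / 2 / n\<close>, and the \<open>n\<close> cells add up to
          \<open>e / 2\<close>.\<close>
        obtain x where x: "x \<in> {a<..<b}" "F b - F a = h x * (b - a)"
          using mvt_simple[OF ab(2), of F "\<lambda>x. (*) (h x)"] der
          unfolding has_field_derivative_def by blast
        have "dist (h b) (h x) < e / 2"
          by (rule d(2)) (use x ab ba nd in \<open>auto simp: dist_real_def\<close>)
        then have "\<bar>h b - h x\<bar> / real n \<le> e / 2 / real n"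
          using npos by (intro divide_right_mono) (auto simp: dist_real_def)
        moreover have "h b / real n - (F b - F a) = (h b - h x) / real n"
          by (simp add: x(2) ba diff_divide_distrib)
        ultimately show ?thesis
          using npos unfolding a_def b_def by (metis abs_divide abs_of_pos)
      qed
      have tele: "(\<Sum>k=1..n. F (real k / real n) - F (real (k - 1) / real n)) = F 1 - F 0"
        using sum_telescope''[of 0 n "\<lambda>k. F (real k / real n)"] npos
        by (simp add: atLeastSucAtMost_greaterThanAtMost)
      have "\<bar>(\<Sum>k=1..n. h (real k / real n)) / real n - (F 1 - F 0)\<bar> =
        \<bar>\<Sum>k=1..n. h (real k / real n) / real n - (F (real k / real n) - F (real (k - 1) / real n))\<bar>"
        unfolding tele[symmetric] by (simp add: sum_subtractf sum_divide_distrib)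
      also have "\<dots> \<le> (\<Sum>k=1..n. e / 2 / real n)"
        by (rule order_trans[OF sum_abs sum_mono[OF step]])
      also have "\<dots> = e / 2" using npos by simp
      finally show "norm ((\<Sum>k=1..n. h (real k / real n)) / real n - (\<integral>s. h s \<partial>lebesgue_on {0..1})) < e"
        using e by (simp add: F1)
    qed
  qed
qed

section \<open>Moments of Bernoulli noise\<close>

lemma bernoulli_noise_AE:
  assumes "bernoulli_noise M \<epsilon>" "k \<ge> 1"
  shows "AE \<omega> in M. \<epsilon> k \<omega> = 1 \<or> \<epsilon> k \<omega> = -1"
proof -
  interpret prob_space M using assms by (simp add: bernoulli_noise_def)
  have [measurable]: "random_variable borel (\<epsilon> k)"
    using assms by (auto simp: bernoulli_noise_def indep_vars_def)
  have "prob ({\<omega> \<in> space M. \<epsilon> k \<omega> = 1} \<union> {\<omega> \<in> space M. \<epsilon> k \<omega> = -1}) = 1"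
    using assms by (subst finite_measure_Union) (auto simp: bernoulli_noise_def)
  from AE_prob_1[OF this] show ?thesis by auto
qed

lemma bernoulli_noise_moment:
  assumes "bernoulli_noise M \<epsilon>" "k \<ge> 1"
  shows "(\<integral>\<omega>. \<epsilon> k \<omega> ^ r \<partial>M) = (if even r then 1 else 0)"
proof -
  interpret prob_space M using assms by (simp add: bernoulli_noise_def)
  have [measurable]: "random_variable borel (\<epsilon> k)"
    using assms by (auto simp: bernoulli_noise_def indep_vars_def)
  note AE = bernoulli_noise_AE[OF assms]
  show ?thesis
  proof (cases "even r")
    case True
    have "(\<integral>\<omega>. \<epsilon> k \<omega> ^ r \<partial>M) = (\<integral>\<omega>. 1 \<partial>M)"
      using AE True by (intro integral_cong_AE) (auto simp: power_minus_even)
    then show ?thesis using True by (simp add: prob_space)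
  next
    case False
    define A B where "A = {\<omega> \<in> space M. \<epsilon> k \<omega> = 1}" and "B = {\<omega> \<in> space M. \<epsilon> k \<omega> = -1}"
    have [measurable]: "A \<in> events" "B \<in> events" unfolding A_def B_def by measurable
    \<comment> \<open>An odd power of a sign is the sign itself, almost surely the difference of the
      two indicators.\<close>
    have "(\<integral>\<omega>. \<epsilon> k \<omega> ^ r \<partial>M) = (\<integral>\<omega>. indicator A \<omega> - indicator B \<omega> \<partial>M)"
    proof (rule integral_cong_AE)
      show "AE \<omega> in M. \<epsilon> k \<omega> ^ r = indicator A \<omega> - indicator B \<omega>"
        using AE AE_space
        by eventually_elim (use False in \<open>auto simp: A_def B_def power_minus_odd\<close>)
    qed measurable
    also have "\<dots> = prob A - prob B"
      by (subst Bochner_Integration.integral_diff) (auto simp: emeasure_eq_measure)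
    also have "\<dots> = 0" using assms unfolding bernoulli_noise_def A_def B_def by auto
    finally show ?thesis using False by simp
  qed
qed

text \<open>Almost surely all signs have modulus 1, so the sum is bounded by the sum of the
  \<open>\<bar>a k\<bar>\<close>.\<close>

lemma bernoulli_sum_integrable:
  assumes "bernoulli_noise M \<epsilon>" "finite A" "A \<subseteq> {1..}"
  shows "integrable M (\<lambda>\<omega>. (\<Sum>k\<in>A. a k * \<epsilon> k \<omega>) ^ r)"
proof -
  interpret prob_space M using assms by (simp add: bernoulli_noise_def)
  have [measurable]: "random_variable borel (\<epsilon> k)" if "k \<in> A" for k
    using assms that by (auto simp: bernoulli_noise_def indep_vars_def)
  have "AE \<omega> in M. \<forall>k\<in>A. \<epsilon> k \<omega> = 1 \<or> \<epsilon> k \<omega> = -1"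
    using assms by (intro AE_finite_allI bernoulli_noise_AE[OF assms(1)]) auto
  then have "AE \<omega> in M. norm ((\<Sum>k\<in>A. a k * \<epsilon> k \<omega>) ^ r) \<le> (\<Sum>k\<in>A. \<bar>a k\<bar>) ^ r"
  proof eventually_elim
    case (elim \<omega>)
    have "\<bar>\<Sum>k\<in>A. a k * \<epsilon> k \<omega>\<bar> \<le> (\<Sum>k\<in>A. \<bar>a k\<bar>)"
      using elim by (intro order_trans[OF sum_abs sum_mono]) (auto simp: abs_mult)
    then show ?case by (simp add: power_abs power_mono)
  qed
  then show ?thesis by (intro integrable_const_bound) auto
qed

text \<open>Independence factors the mixed moments, so after division by \<open>fact r\<close> the
  binomial theorem becomes the Cauchy product of moment series. A single weighted sign has only even
  moments, those of \<open>cosh_fps\<close>.\<close>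

lemma bernoulli_sum_moment:
  assumes "bernoulli_noise M \<epsilon>" "finite A" "A \<subseteq> {1..}"
  shows "(\<integral>\<omega>. (\<Sum>k\<in>A. a k * \<epsilon> k \<omega>) ^ r \<partial>M) = fact r * fps_nth (\<Prod>k\<in>A. cosh_fps (a k)) r"
  using assms(2,3)
proof (induction A arbitrary: r rule: finite_induct)
  case empty
  interpret prob_space M using assms by (simp add: bernoulli_noise_def)
  show ?case by (cases r) (simp_all add: prob_space)
next
  case (insert i A)
  interpret prob_space M using assms by (simp add: bernoulli_noise_def)
  define X Y where "X \<omega> = a i * \<epsilon> i \<omega>" and "Y \<omega> = (\<Sum>k\<in>A. a k * \<epsilon> k \<omega>)" for \<omega>
  have i: "i \<ge> 1" and A: "A \<subseteq> {1..}" using insert by auto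
  have "indep_vars (\<lambda>_. borel) \<epsilon> (insert i A)"
    using assms(1) insert.prems unfolding bernoulli_noise_def by (auto intro: indep_vars_subset)
  then have "indep_vars (\<lambda>_. borel) (\<lambda>k \<omega>. a k * \<epsilon> k \<omega>) (insert i A)"
    by (rule indep_vars_compose2) auto
  from indep_vars_sum[OF insert.hyps this] have indep: "indep_var borel X borel Y"
    by (simp add: X_def[abs_def] Y_def[abs_def])
  have intX: "integrable M (\<lambda>\<omega>. X \<omega> ^ j)" and intY: "integrable M (\<lambda>\<omega>. Y \<omega> ^ j)" for j
    using bernoulli_sum_integrable[OF assms(1), of "{i}" a j] i
      bernoulli_sum_integrable[OF assms(1) insert.hyps(1) A, of a j]
    by (simp_all add: X_def Y_def)
  have indep': "indep_var borel (\<lambda>\<omega>. X \<omega> ^ j) borel (\<lambda>\<omega>. Y \<omega> ^ l)" for j l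
    using indep_var_compose[OF indep, of "\<lambda>x. x ^ j" borel "\<lambda>x. x ^ l" borel] by (simp add: o_def)
  have EX: "(\<integral>\<omega>. X \<omega> ^ j \<partial>M) = fact j * fps_nth (cosh_fps (a i)) j" for j
    using bernoulli_noise_moment[OF assms(1) i, of j] by (simp add: X_def power_mult_distrib cosh_fps_def)
  have "(\<integral>\<omega>. (\<Sum>k\<in>insert i A. a k * \<epsilon> k \<omega>) ^ r \<partial>M) = (\<integral>\<omega>. (X \<omega> + Y \<omega>) ^ r \<partial>M)"
    using insert.hyps by (simp add: X_def Y_def)
  also have "\<dots> = (\<Sum>j\<le>r. real (r choose j) * (\<integral>\<omega>. X \<omega> ^ j * Y \<omega> ^ (r - j) \<partial>M))"
    unfolding binomial_ring using indep_var_integrable[OF indep' intX intY]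
    by (simp add: mult.assoc)
  also have "\<dots> = (\<Sum>j\<le>r. real (r choose j) * ((fact j * fps_nth (cosh_fps (a i)) j) *
      (fact (r - j) * fps_nth (\<Prod>k\<in>A. cosh_fps (a k)) (r - j))))"
    using insert.IH[OF A] unfolding indep_var_lebesgue_integral[OF indep' intX intY] EX
    by (simp add: Y_def)
  also have "\<dots> = fact r * (\<Sum>j\<le>r. fps_nth (cosh_fps (a i)) j * fps_nth (\<Prod>k\<in>A. cosh_fps (a k)) (r - j))"
    unfolding sum_distrib_left
    by (intro sum.cong refl) (simp add: binomial_fact)
  also have "\<dots> = fact r * fps_nth (\<Prod>k\<in>insert i A. cosh_fps (a k)) r"
    using insert.hyps by (simp add: fps_mult_nth atMost_atLeast0)
  finally show ?case .
qed

lemma bernoulli_pairing_altdef: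
  "bernoulli_pairing \<epsilon> n f \<omega> = (\<Sum>k\<in>{1..n}. f (real k / real n) / sqrt (real n) * \<epsilon> k \<omega>)"
  by (simp add: bernoulli_pairing_def)

text \<open>Linearity in the test function makes each partial sum from polarization a single
  pairing.\<close>

lemma bernoulli_pairing_sum:
  "bernoulli_pairing \<epsilon> n (\<lambda>s. \<Sum>t\<in>T. g t s) \<omega> = (\<Sum>t\<in>T. bernoulli_pairing \<epsilon> n (g t) \<omega>)"
  unfolding bernoulli_pairing_def sum_distrib_right by (rule sum.swap)

lemma bernoulli_pairing_integrable:
  assumes "bernoulli_noise M \<epsilon>"
  shows "integrable M (\<lambda>\<omega>. bernoulli_pairing \<epsilon> n f \<omega> ^ r)"
  unfolding bernoulli_pairing_altdef by (rule bernoulli_sum_integrable[OF assms]) auto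

text \<open>The squared weights form a Riemann sum for f^2. As \<open>f\<close> is bounded on the
  compact interval, the power sums of order at least 3 are O(1 / sqrt n), so
  \<open>fps_nth_prod_cosh_fps_tendsto\<close> applies.\<close>

lemma bernoulli_pairing_moment_tendsto:
  assumes "bernoulli_noise M \<epsilon>" and cont: "continuous_on {0..1} f"
  shows "(\<lambda>n. \<integral>\<omega>. bernoulli_pairing \<epsilon> n f \<omega> ^ r \<partial>M)
    \<longlonglongrightarrow> gauss_moment (\<integral>s. (f s)\<^sup>2 \<partial>lebesgue_on {0..1}) r"
proof -
  define a where "a n k = f (real k / real n) / sqrt (real n)" for n k
  define v where "v = (\<integral>s. (f s)\<^sup>2 \<partial>lebesgue_on {0..1})"
  have var: "(\<lambda>n. \<Sum>k\<in>{1..n}. (a n k)\<^sup>2) \<longlonglongrightarrow> v"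
    using riemann_sum_tendsto[of "\<lambda>s. (f s)\<^sup>2"] cont
    by (simp add: a_def v_def power_divide sum_divide_distrib continuous_intros)
  have "bounded (f ` {0..1})"
    by (intro compact_imp_bounded compact_continuous_image cont) simp
  then obtain B where B: "B > 0" "\<And>s. s \<in> {0..1} \<Longrightarrow> \<bar>f s\<bar> \<le> B"
    unfolding bounded_pos by auto
  have higher: "(\<lambda>n. \<Sum>k\<in>{1..n}. a n k ^ j) \<longlonglongrightarrow> 0" if j: "j \<ge> 3" for j
  proof (rule Lim_null_comparison)
    show "(\<lambda>n. B ^ j * inverse (sqrt (real n))) \<longlonglongrightarrow> 0"
      by (intro tendsto_mult_right_zero tendsto_inverse_0_at_top
        filterlim_compose[OF sqrt_at_top filterlim_real_sequentially])
    show "\<forall>\<^sub>F n in sequentially. norm (\<Sum>k\<in>{1..n}. a n k ^ j) \<le> B ^ j * inverse (sqrt (real n))"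
      \<comment> \<open>From \<open>n = 1\<close> on, \<open>s \<ge> 1\<close>, so \<open>n\<close>
        terms of size at most (B/s)^j add up to at most B^j s^2 / s^3.\<close>
      using eventually_ge_at_top[of 1]
    proof eventually_elim
      case (elim n)
      define s where "s = sqrt (real n)"
      have s: "s \<ge> 1" "s ^ 2 = real n" "n \<ge> 1" using elim by (simp_all add: s_def)
      have "\<bar>a n k\<bar> ^ j \<le> (B / s) ^ j" if "k \<in> {1..n}" for k
      proof (rule power_mono)
        have "\<bar>f (real k / real n)\<bar> \<le> B" using that by (intro B(2)) auto
        then show "\<bar>a n k\<bar> \<le> B / s"
          using s by (simp add: a_def abs_divide divide_right_mono flip: s_def)
      qed simp
      then have "norm (\<Sum>k\<in>{1..n}. a n k ^ j) \<le> (\<Sum>k\<in>{1..n}. (B / s) ^ j)"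
        by (intro order_trans[OF norm_sum sum_mono]) (simp add: power_abs)
      also have "\<dots> = s ^ 2 * (B / s) ^ j" using s by simp
      also have "\<dots> = B ^ j * (s ^ 2 / s ^ j)" by (simp add: power_divide)
      also have "\<dots> \<le> B ^ j * (s ^ 2 / s ^ 3)"
        using s B j by (intro mult_left_mono divide_left_mono power_increasing) auto
      also have "s ^ 2 / s ^ 3 = inverse s" using s(1) by (simp add: power2_eq_square power3_eq_cube divide_simps)
      finally show ?case by (simp add: s_def)
    qed
  qed
  have "(\<lambda>n. fact r * fps_nth (\<Prod>k\<in>{1..n}. cosh_fps (a n k)) r)
      \<longlonglongrightarrow> fact r * (gauss_moment v r / fact r)"
    by (intro tendsto_mult tendsto_const fps_nth_prod_cosh_fps_tendsto var higher) auto
  moreover have "(\<integral>\<omega>. bernoulli_pairing \<epsilon> n f \<omega> ^ r \<partial>M) =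
      fact r * fps_nth (\<Prod>k\<in>{1..n}. cosh_fps (a n k)) r" for n
    unfolding bernoulli_pairing_altdef a_def by (rule bernoulli_sum_moment[OF assms(1)]) auto
  ultimately show ?thesis by (simp add: v_def)
qed

section \<open>Moments of centered Gaussian variables\<close>

lemma gaussian_rv_moments:
  assumes "prob_space W" "gaussian_rv W Z" "(\<integral>\<omega>. Z \<omega> \<partial>W) = 0"
  shows "integrable W (\<lambda>\<omega>. Z \<omega> ^ r)"
    and "(\<integral>\<omega>. Z \<omega> ^ r \<partial>W) = gauss_moment (\<integral>\<omega>. (Z \<omega>)\<^sup>2 \<partial>W) r"
proof -
  interpret prob_space W by fact
  have [measurable]: "Z \<in> borel_measurable W" using assms by (simp add: gaussian_rv_def)
  have "integrable W (\<lambda>\<omega>. Z \<omega> ^ r) \<and> (\<integral>\<omega>. Z \<omega> ^ r \<partial>W) = gauss_moment (\<integral>\<omega>. (Z \<omega>)\<^sup>2 \<partial>W) r"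
    using assms(2) unfolding gaussian_rv_def
  proof (elim conjE disjE exE)
    fix \<mu> \<sigma> :: real
    assume \<sigma>: "\<sigma> > 0" and D: "distributed W lborel Z (\<lambda>x. ennreal (normal_density \<mu> \<sigma> x))"
    have "\<mu> = 0" using normal_distributed_expectation[OF \<sigma> D] assms(3) by simp
    have *: "integrable W (\<lambda>\<omega>. Z \<omega> ^ r) \<and> (\<integral>\<omega>. Z \<omega> ^ r \<partial>W) = gauss_moment (\<sigma>\<^sup>2) r" for r
    proof -
      have "has_bochner_integral lborel (\<lambda>x. normal_density 0 \<sigma> x * x ^ r) (gauss_moment (\<sigma>\<^sup>2) r)"
      proof (cases "even r")
        case True
        then obtain k where "r = 2 * k" by (elim evenE)
        then show ?thesis
          using normal_moment_even[OF \<sigma>, of 0 k] \<sigma> by (simp add: gauss_moment_def power_divide)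
      next
        case False
        then obtain k where "r = 2 * k + 1" by (elim oddE)
        then show ?thesis
          using normal_moment_odd[OF \<sigma>, of 0 k] by (simp add: gauss_moment_def)
      qed
      then show ?thesis
        using distributed_integrable[OF D, of "\<lambda>x. x ^ r"] distributed_integral[OF D, of "\<lambda>x. x ^ r"]
        by (simp add: \<open>\<mu> = 0\<close> has_bochner_integral_iff)
    qed
    \<comment> \<open>The case \<open>r = 2\<close> of \<open>*\<close> identifies the density
      parameter with the second moment named in the claim.\<close>
    have "gauss_moment (\<sigma>\<^sup>2) 2 = \<sigma>\<^sup>2" by (simp add: gauss_moment_def)
    then show ?thesis using * by metis
  next
    fix \<mu> assume AE: "AE \<omega> in W. Z \<omega> = \<mu>"
    have const: "integrable W (\<lambda>\<omega>. Z \<omega> ^ r) \<and> (\<integral>\<omega>. Z \<omega> ^ r \<partial>W) = \<mu> ^ r" for r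
    proof -
      have AEr: "AE \<omega> in W. \<mu> ^ r = Z \<omega> ^ r" using AE by auto
      have "integrable W (\<lambda>\<omega>. Z \<omega> ^ r)"
        by (rule integrable_cong_AE_imp[OF _ _ AEr]) auto
      moreover have "(\<integral>\<omega>. Z \<omega> ^ r \<partial>W) = (\<integral>\<omega>. \<mu> ^ r \<partial>W)"
        using AEr by (intro integral_cong_AE) auto
      ultimately show ?thesis by (simp add: prob_space)
    qed
    \<comment> \<open>A constant with mean 0 is 0, and \<open>gauss_moment 0 r\<close> agrees with
      \<open>0 ^ r\<close>, both being 1 at \<open>r = 0\<close>.\<close>
    have "\<mu> = 0" using const[of 1] assms(3) by simp
    then show ?thesis
      using const[of r] const[of 2] by (auto simp: gauss_moment_def power_0_left elim!: evenE oddE)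
  qed
  then show "integrable W (\<lambda>\<omega>. Z \<omega> ^ r)"
    and "(\<integral>\<omega>. Z \<omega> ^ r \<partial>W) = gauss_moment (\<integral>\<omega>. (Z \<omega>)\<^sup>2 \<partial>W) r" by auto
qed

section \<open>Coefficients of Wick polynomials in terms of moments\<close>

lemma poly_eq_sum_atMost:
  assumes "degree p \<le> d"
  shows "poly p (x::'a::comm_semiring_1) = (\<Sum>i\<le>d. coeff p i * x ^ i)"
  unfolding poly_altdef using assms
  by (intro sum.mono_neutral_left) (auto simp: coeff_eq_0)

text \<open>Each integration raises the degree by at most one. The bound gives expansions whose
  range of summation is the same for all \<open>n\<close>.\<close>

lemma wick_sequence_degree:
  assumes "is_wick_sequence M \<eta> P"
  shows "degree (P m) \<le> m"
proof (induction m)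
  case (Suc m)
  have "pderiv (P (Suc m)) = smult (of_nat (Suc m)) (P m)"
    using assms unfolding is_wick_sequence_def by (metis diff_Suc_1 le_add1 plus_1_eq_Suc)
  then have "degree (P (Suc m)) - 1 \<le> m"
    using Suc degree_pderiv[of "P (Suc m)"] degree_smult_le[of "of_nat (Suc m)" "P m"] by simp
  then show ?case by simp
qed (use assms in \<open>simp add: is_wick_sequence_def\<close>)

lemma wick_sequence_coeff_Suc:
  assumes "is_wick_sequence M \<eta> P"
  shows "coeff (P (Suc m)) (Suc j) = real (Suc m) * coeff (P m) j / real (Suc j)"
proof -
  have "pderiv (P (Suc m)) = smult (of_nat (Suc m)) (P m)"
    using assms unfolding is_wick_sequence_def by (metis diff_Suc_1 le_add1 plus_1_eq_Suc)
  then have "coeff (pderiv (P (Suc m))) j = real (Suc m) * coeff (P m) j" by simp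
  then have "real (Suc j) * coeff (P (Suc m)) (Suc j) = real (Suc m) * coeff (P m) j"
    by (simp add: coeff_pderiv)
  then show ?thesis by (simp add: field_simps del: of_nat_Suc)
qed

text \<open>The derivative rule leaves only the constant coefficient free. The vanishing mean then
  determines it from the moments of orders 1 to \<open>Suc m\<close>, the moment of order 0 being
  the total mass 1.\<close>

lemma wick_sequence_coeff_0:
  assumes "prob_space M" "\<And>k. integrable M (\<lambda>\<omega>. \<eta> \<omega> ^ k)" "is_wick_sequence M \<eta> P"
  shows "coeff (P (Suc m)) 0 = - (\<Sum>j\<le>m. coeff (P (Suc m)) (Suc j) * (\<integral>\<omega>. \<eta> \<omega> ^ Suc j \<partial>M))"
proof -
  interpret prob_space M by fact
  have "0 = (\<integral>\<omega>. poly (P (Suc m)) (\<eta> \<omega>) \<partial>M)"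
    using assms(3) by (simp add: is_wick_sequence_def)
  also have "\<dots> = (\<Sum>i\<le>Suc m. coeff (P (Suc m)) i * (\<integral>\<omega>. \<eta> \<omega> ^ i \<partial>M))"
    unfolding poly_eq_sum_atMost[OF wick_sequence_degree[OF assms(3)]]
    using assms(2) by (subst Bochner_Integration.integral_sum) auto
  finally show ?thesis
    by (simp add: sum.atMost_Suc_shift prob_space del: power_Suc sum.atMost_Suc)
qed

text \<open>The two coefficient recursions use only sums, products and fixed divisors, so
  convergence of moments carries over by induction on \<open>m\<close>.\<close>

lemma wick_poly_coeff_tendsto:
  assumes M: "prob_space M" "\<And>n k. integrable M (\<lambda>\<omega>. X n \<omega> ^ k)"
    and W: "prob_space W" "\<And>k. integrable W (\<lambda>\<omega>. Y \<omega> ^ k)"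
    and lim: "\<And>k. (\<lambda>n. \<integral>\<omega>. X n \<omega> ^ k \<partial>M) \<longlonglongrightarrow> (\<integral>\<omega>. Y \<omega> ^ k \<partial>W)"
  shows "(\<lambda>n. coeff (wick_poly M (X n) m) j) \<longlonglongrightarrow> coeff (wick_poly W Y m) j"
proof -
  note PX = is_wick_sequence_wick_poly[OF M] and PY = is_wick_sequence_wick_poly[OF W]
  show ?thesis
  proof (induction m arbitrary: j)
    case 0
    then show ?case using PX PY by (simp add: is_wick_sequence_def)
  next
    case (Suc m)
    \<comment> \<open>Positive degrees come first because the constant coefficient is computed from
      them.\<close>
    have pos: "(\<lambda>n. coeff (wick_poly M (X n) (Suc m)) (Suc j)) \<longlonglongrightarrow> coeff (wick_poly W Y (Suc m)) (Suc j)" for j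
      unfolding wick_sequence_coeff_Suc[OF PX] wick_sequence_coeff_Suc[OF PY]
      by (intro tendsto_intros Suc.IH) auto
    show ?case
    proof (cases j)
      case 0
      show ?thesis
        unfolding 0 wick_sequence_coeff_0[OF M PX] wick_sequence_coeff_0[OF W PY]
        by (intro tendsto_intros pos lim)
    qed (use pos in simp)
  qed
qed

section \<open>Joint moments of Bernoulli noise and white noise\<close>

lemma
  fixes x :: "'i \<Rightarrow> 'a \<Rightarrow> real"
  assumes fin: "finite S"
    and int: "\<And>T. T \<subseteq> S \<Longrightarrow> integrable M (\<lambda>\<omega>. (\<Sum>t\<in>T. x t \<omega>) ^ card S)"
  shows integrable_prod_polarization: "integrable M (\<lambda>\<omega>. \<Prod>t\<in>S. x t \<omega>)"
    and integral_prod_polarization: "(\<integral>\<omega>. (\<Prod>t\<in>S. x t \<omega>) \<partial>M) =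
      (\<Sum>T\<in>Pow S. (-1) ^ (card S - card T) / fact (card S) * (\<integral>\<omega>. (\<Sum>t\<in>T. x t \<omega>) ^ card S \<partial>M))"
  \<comment> \<open>Polarization holds at each \<omega>, so the product inherits integrability and
    its integral termwise from powers of sums.\<close>
  unfolding polarization[OF fin] using int by auto

lemma continuous_L2_unit:
  assumes "continuous_on {0..1} f"
  shows "f \<in> L2_unit"
  unfolding L2_unit_def using assms
  by (auto intro!: continuous_imp_measurable_on_sets_lebesgue continuous_imp_integrable_real continuous_intros)

text \<open>\<open>jointly_gaussian\<close> speaks of weighted sums over sets of functions, while
  \<open>g\<close> may repeat a function. Grouping equal functions turns multiplicities into
  weights. Repetitions do occur later, where powers become repeated factors.\<close>

lemma white_noise_sum_gaussian:
  assumes "white_noise W \<xi>" "finite T" "\<And>t. t \<in> T \<Longrightarrow> g t \<in> L2_unit"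
  shows "gaussian_rv W (\<lambda>\<omega>. \<Sum>t\<in>T. \<xi> (g t) \<omega>)"
proof -
  have jg: "jointly_gaussian W L2_unit \<xi>" using assms(1) by (simp add: white_noise_def)
  have sub: "finite (g ` T)" "g ` T \<subseteq> L2_unit" using assms(2,3) by auto
  have "gaussian_rv W (\<lambda>\<omega>. \<Sum>h\<in>g ` T. real (card {t \<in> T. g t = h}) * \<xi> h \<omega>)"
    by (rule jg[unfolded jointly_gaussian_def, rule_format, OF sub])
  also have "(\<lambda>\<omega>. \<Sum>h\<in>g ` T. real (card {t \<in> T. g t = h}) * \<xi> h \<omega>) = (\<lambda>\<omega>. \<Sum>t\<in>T. \<xi> (g t) \<omega>)"
  proof
    fix \<omega>
    have "(\<Sum>t\<in>T. \<xi> (g t) \<omega>) = (\<Sum>h\<in>g ` T. \<Sum>t\<in>{t \<in> T. g t = h}. \<xi> (g t) \<omega>)"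
      by (rule sum.image_gen[OF assms(2)])
    also have "\<dots> = (\<Sum>h\<in>g ` T. real (card {t \<in> T. g t = h}) * \<xi> h \<omega>)"
      by (intro sum.cong refl) simp
    finally show "(\<Sum>h\<in>g ` T. real (card {t \<in> T. g t = h}) * \<xi> h \<omega>) = (\<Sum>t\<in>T. \<xi> (g t) \<omega>)" ..
  qed
  finally show ?thesis .
qed

text \<open>The moments of a centered Gaussian variable depend only on its variance. Expanding the
  square turns the variance into covariances, and the integrals they equal recombine into that of a
  squared sum, with no appeal to linearity of \<open>\<xi>\<close> in its argument.\<close>

lemma
  assumes W: "white_noise W \<xi>" and fin: "finite T"
    and cont: "\<And>t. t \<in> T \<Longrightarrow> continuous_on {0..1} (g t)"
  shows white_noise_sum_integrable: "integrable W (\<lambda>\<omega>. (\<Sum>t\<in>T. \<xi> (g t) \<omega>) ^ r)"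
    and white_noise_sum_moment: "(\<integral>\<omega>. (\<Sum>t\<in>T. \<xi> (g t) \<omega>) ^ r \<partial>W) =
      gauss_moment (\<integral>s. (\<Sum>t\<in>T. g t s)\<^sup>2 \<partial>lebesgue_on {0..1}) r"
proof -
  have ps: "prob_space W" using W by (simp add: white_noise_def)
  have L2: "g t \<in> L2_unit" if "t \<in> T" for t using continuous_L2_unit[OF cont[OF that]] .
  have int1: "integrable W (\<lambda>\<omega>. \<xi> (g t) \<omega> ^ k)" if "t \<in> T" for t k
    using gaussian_rv_moments(1)[OF ps] white_noise_sum_gaussian[OF W, of "{t}" g] L2[OF that] W
    by (simp add: white_noise_def)
  have meas: "\<xi> (g t) \<in> borel_measurable W" if "t \<in> T" for t
    using borel_measurable_integrable[OF int1[OF that, of 1]] by simp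
  \<comment> \<open>Expanding the square under the integral requires integrable products; these are
    dominated by the sum of the squares.\<close>
  have int2: "integrable W (\<lambda>\<omega>. \<xi> (g t) \<omega> * \<xi> (g u) \<omega>)" if "t \<in> T" "u \<in> T" for t u
  proof (rule Bochner_Integration.integrable_bound)
    show "integrable W (\<lambda>\<omega>. \<xi> (g t) \<omega> ^ 2 + \<xi> (g u) \<omega> ^ 2)"
      using int1 that by auto
    show "AE \<omega> in W. norm (\<xi> (g t) \<omega> * \<xi> (g u) \<omega>) \<le> norm (\<xi> (g t) \<omega> ^ 2 + \<xi> (g u) \<omega> ^ 2)"
    proof (rule AE_I2)
      fix \<omega>
      have "2 * \<bar>\<xi> (g t) \<omega>\<bar> * \<bar>\<xi> (g u) \<omega>\<bar> \<le> \<bar>\<xi> (g t) \<omega>\<bar> ^ 2 + \<bar>\<xi> (g u) \<omega>\<bar> ^ 2"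
        by (rule sum_squares_bound)
      moreover have "0 \<le> \<bar>\<xi> (g t) \<omega>\<bar> * \<bar>\<xi> (g u) \<omega>\<bar>" by simp
      ultimately have "\<bar>\<xi> (g t) \<omega>\<bar> * \<bar>\<xi> (g u) \<omega>\<bar> \<le> \<bar>\<xi> (g t) \<omega>\<bar> ^ 2 + \<bar>\<xi> (g u) \<omega>\<bar> ^ 2" by linarith
      then show "norm (\<xi> (g t) \<omega> * \<xi> (g u) \<omega>) \<le> norm (\<xi> (g t) \<omega> ^ 2 + \<xi> (g u) \<omega> ^ 2)"
        by (simp add: abs_mult)
    qed
  qed (use meas that in auto)
  have mean: "(\<integral>\<omega>. (\<Sum>t\<in>T. \<xi> (g t) \<omega>) \<partial>W) = 0"
    using int1[of _ 1] L2 W by (simp add: white_noise_def)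
  have "(\<integral>\<omega>. (\<Sum>t\<in>T. \<xi> (g t) \<omega>)\<^sup>2 \<partial>W) = (\<Sum>t\<in>T. \<Sum>u\<in>T. \<integral>\<omega>. \<xi> (g t) \<omega> * \<xi> (g u) \<omega> \<partial>W)"
    unfolding power2_eq_square sum_product using int2 by simp
  also have "\<dots> = (\<Sum>t\<in>T. \<Sum>u\<in>T. \<integral>s. g t s * g u s \<partial>lebesgue_on {0..1})"
    using L2 W by (simp add: white_noise_def)
  also have "\<dots> = (\<integral>s. (\<Sum>t\<in>T. g t s)\<^sup>2 \<partial>lebesgue_on {0..1})"
  proof -
    have "integrable (lebesgue_on {0..1}) (\<lambda>s. g t s * g u s)" if "t \<in> T" "u \<in> T" for t u
      using cont that by (intro continuous_imp_integrable_real continuous_intros) auto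
    then show ?thesis unfolding power2_eq_square sum_product by simp
  qed
  finally have var: "(\<integral>\<omega>. (\<Sum>t\<in>T. \<xi> (g t) \<omega>)\<^sup>2 \<partial>W) =
      (\<integral>s. (\<Sum>t\<in>T. g t s)\<^sup>2 \<partial>lebesgue_on {0..1})" .
  note moments = gaussian_rv_moments[OF ps white_noise_sum_gaussian[OF W fin L2] mean]
  show "integrable W (\<lambda>\<omega>. (\<Sum>t\<in>T. \<xi> (g t) \<omega>) ^ r)" by (rule moments)
  show "(\<integral>\<omega>. (\<Sum>t\<in>T. \<xi> (g t) \<omega>) ^ r \<partial>W) =
      gauss_moment (\<integral>s. (\<Sum>t\<in>T. g t s)\<^sup>2 \<partial>lebesgue_on {0..1}) r"
    using moments(2)[of r] by (simp add: var)
qed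

text \<open>Polarization writes both joint moments as the same combination, over
  \<open>T \<subseteq> S\<close>, of moments of sums. For each \<open>T\<close> both sides lead to
  the same Gaussian moment, whose variance is the integral of the squared sum of the
  \<open>g t\<close>.\<close>

lemma
  assumes M: "bernoulli_noise M \<epsilon>" and W: "white_noise W \<xi>" and fin: "finite S"
    and cont: "\<And>t. t \<in> S \<Longrightarrow> continuous_on {0..1} (g t)"
  shows bernoulli_pairing_prod_integrable: "integrable M (\<lambda>\<omega>. \<Prod>t\<in>S. bernoulli_pairing \<epsilon> n (g t) \<omega>)"
    and white_noise_prod_integrable: "integrable W (\<lambda>\<omega>. \<Prod>t\<in>S. \<xi> (g t) \<omega>)"
    and joint_moment_tendsto: "(\<lambda>n. \<integral>\<omega>. (\<Prod>t\<in>S. bernoulli_pairing \<epsilon> n (g t) \<omega>) \<partial>M)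
      \<longlonglongrightarrow> (\<integral>\<omega>. (\<Prod>t\<in>S. \<xi> (g t) \<omega>) \<partial>W)"
proof -
  have intM: "integrable M (\<lambda>\<omega>. (\<Sum>t\<in>T. bernoulli_pairing \<epsilon> n (g t) \<omega>) ^ card S)" for T n
    unfolding bernoulli_pairing_sum[symmetric] by (rule bernoulli_pairing_integrable[OF M])
  have sub: "finite T" "\<And>t. t \<in> T \<Longrightarrow> continuous_on {0..1} (g t)" if "T \<subseteq> S" for T
    using that cont finite_subset[OF that fin] by auto
  have intW: "integrable W (\<lambda>\<omega>. (\<Sum>t\<in>T. \<xi> (g t) \<omega>) ^ card S)" if "T \<subseteq> S" for T
    by (rule white_noise_sum_integrable[OF W sub[OF that]])
  show "integrable M (\<lambda>\<omega>. \<Prod>t\<in>S. bernoulli_pairing \<epsilon> n (g t) \<omega>)"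
    by (rule integrable_prod_polarization[OF fin intM])
  show "integrable W (\<lambda>\<omega>. \<Prod>t\<in>S. \<xi> (g t) \<omega>)"
    by (rule integrable_prod_polarization[OF fin intW])
  have lim: "(\<lambda>n. \<integral>\<omega>. (\<Sum>t\<in>T. bernoulli_pairing \<epsilon> n (g t) \<omega>) ^ card S \<partial>M)
      \<longlonglongrightarrow> (\<integral>\<omega>. (\<Sum>t\<in>T. \<xi> (g t) \<omega>) ^ card S \<partial>W)" if "T \<subseteq> S" for T
  proof -
    have "(\<integral>\<omega>. (\<Sum>t\<in>T. \<xi> (g t) \<omega>) ^ card S \<partial>W) =
        gauss_moment (\<integral>s. (\<Sum>t\<in>T. g t s)\<^sup>2 \<partial>lebesgue_on {0..1}) (card S)"
      by (rule white_noise_sum_moment[OF W sub[OF that]])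
    then show ?thesis
      unfolding bernoulli_pairing_sum[symmetric]
      by (auto intro!: bernoulli_pairing_moment_tendsto[OF M] continuous_on_sum sub(2)[OF that])
  qed
  have "(\<integral>\<omega>. (\<Prod>t\<in>S. \<xi> (g t) \<omega>) \<partial>W) =
      (\<Sum>T\<in>Pow S. (-1) ^ (card S - card T) / fact (card S) * (\<integral>\<omega>. (\<Sum>t\<in>T. \<xi> (g t) \<omega>) ^ card S \<partial>W))"
    by (rule integral_prod_polarization[OF fin intW])
  then show "(\<lambda>n. \<integral>\<omega>. (\<Prod>t\<in>S. bernoulli_pairing \<epsilon> n (g t) \<omega>) \<partial>M)
      \<longlonglongrightarrow> (\<integral>\<omega>. (\<Prod>t\<in>S. \<xi> (g t) \<omega>) \<partial>W)"
    unfolding integral_prod_polarization[OF fin intM]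
    by (simp only:) (intro tendsto_sum tendsto_mult tendsto_const lim; auto)
qed

section \<open>Expectations of products of Wick powers\<close>

lemma integral_prod_poly:
  fixes X :: "'i \<Rightarrow> 'a \<Rightarrow> real"
  assumes fin: "finite I" and deg: "\<And>i. i \<in> I \<Longrightarrow> degree (P i) \<le> d i"
    and int: "\<And>k. integrable M (\<lambda>\<omega>. \<Prod>i\<in>I. X i \<omega> ^ k i)"
  shows "(\<integral>\<omega>. (\<Prod>i\<in>I. poly (P i) (X i \<omega>)) \<partial>M) =
    (\<Sum>k\<in>PiE I (\<lambda>i. {..d i}). (\<Prod>i\<in>I. coeff (P i) (k i)) * (\<integral>\<omega>. (\<Prod>i\<in>I. X i \<omega> ^ k i) \<partial>M))"
proof -
  have "(\<Prod>i\<in>I. poly (P i) (X i \<omega>)) =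
      (\<Sum>k\<in>PiE I (\<lambda>i. {..d i}). (\<Prod>i\<in>I. coeff (P i) (k i)) * (\<Prod>i\<in>I. X i \<omega> ^ k i))" for \<omega>
  proof -
    have "(\<Prod>i\<in>I. poly (P i) (X i \<omega>)) = (\<Prod>i\<in>I. \<Sum>j\<le>d i. coeff (P i) j * X i \<omega> ^ j)"
      by (intro prod.cong refl poly_eq_sum_atMost deg)
    \<comment> \<open>Multiplying out picks one degree \<open>k i\<close> in each factor;
      \<open>PiE\<close> collects these choices.\<close>
    then show ?thesis using fin by (simp add: prod_sum_PiE prod.distrib)
  qed
  then show ?thesis using int by simp
qed

theorem mainTheorem4:
  fixes M :: "'a measure" and \<epsilon> :: "nat \<Rightarrow> 'a \<Rightarrow> real"
    and W :: "'b measure" and \<xi> :: "(real \<Rightarrow> real) \<Rightarrow> 'b \<Rightarrow> real"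
    and N :: nat and m :: "nat \<Rightarrow> nat" and f :: "nat \<Rightarrow> real \<Rightarrow> real"
  assumes "bernoulli_noise M \<epsilon>"
    and "white_noise W \<xi>"
    and "N \<ge> 1"
    and "\<And>i. i \<in> {1..N} \<Longrightarrow> m i \<ge> 1"
    and "\<And>i. i \<in> {1..N} \<Longrightarrow> continuous_on {0..1} (f i)"
  shows "(\<lambda>n. \<integral>\<omega>. (\<Prod>i=1..N. wick_power M (bernoulli_pairing \<epsilon> n (f i)) (m i) \<omega>) \<partial>M)
           \<longlonglongrightarrow> (\<integral>\<omega>. (\<Prod>i=1..N. wick_power W (\<xi> (f i)) (m i) \<omega>) \<partial>W)"
proof -
  note M = assms(1) and W = assms(2) and cont = assms(5)
  have pM: "prob_space M" and pW: "prob_space W"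
    using M W by (simp_all add: bernoulli_noise_def white_noise_def)
  have intW: "integrable W (\<lambda>\<omega>. \<xi> (f i) \<omega> ^ k)"
    and lim: "(\<lambda>n. \<integral>\<omega>. bernoulli_pairing \<epsilon> n (f i) \<omega> ^ k \<partial>M) \<longlonglongrightarrow> (\<integral>\<omega>. \<xi> (f i) \<omega> ^ k \<partial>W)"
    if "i \<in> {1..N}" for i k
    using white_noise_sum_integrable[OF W, of "{i}" f k] white_noise_sum_moment[OF W, of "{i}" f k]
      bernoulli_pairing_moment_tendsto[OF M cont[OF that], of k] cont[OF that] by simp_all
  note intM = bernoulli_pairing_integrable[OF M]
  \<comment> \<open>Each power is spread over copies (i, l) with l < k i, so that the joint moment
    lemmas apply to a plain product in which \<open>f i\<close> occurs \<open>k i\<close>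
    times.\<close>
  have powers: "(\<Prod>i\<in>{1..N}. y i ^ k i) = (\<Prod>t\<in>Sigma {1..N} (\<lambda>i. {..<k i}). y (fst t))"
    for y :: "nat \<Rightarrow> real" and k :: "nat \<Rightarrow> nat"
    using prod.Sigma[of "{1..N}" "\<lambda>i. {..<k i}" "\<lambda>i _. y i"] by (simp add: case_prod_beta)
  have joint:
    "integrable M (\<lambda>\<omega>. \<Prod>i\<in>{1..N}. bernoulli_pairing \<epsilon> n (f i) \<omega> ^ k i)"
    "integrable W (\<lambda>\<omega>. \<Prod>i\<in>{1..N}. \<xi> (f i) \<omega> ^ k i)"
    "(\<lambda>n. \<integral>\<omega>. (\<Prod>i\<in>{1..N}. bernoulli_pairing \<epsilon> n (f i) \<omega> ^ k i) \<partial>M)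
      \<longlonglongrightarrow> (\<integral>\<omega>. (\<Prod>i\<in>{1..N}. \<xi> (f i) \<omega> ^ k i) \<partial>W)" for k n
    unfolding powers
    using cont by (intro bernoulli_pairing_prod_integrable[OF M W]
      white_noise_prod_integrable[OF M W] joint_moment_tendsto[OF M W]; auto)+
  have degM: "degree (wick_poly M (bernoulli_pairing \<epsilon> n (f i)) (m i)) \<le> m i" for n i
    by (rule wick_sequence_degree[OF is_wick_sequence_wick_poly[OF pM intM]])
  have degW: "degree (wick_poly W (\<xi> (f i)) (m i)) \<le> m i" if "i \<in> {1..N}" for i
    by (rule wick_sequence_degree[OF is_wick_sequence_wick_poly[OF pW intW[OF that]]])
  have coeff: "(\<lambda>n. coeff (wick_poly M (bernoulli_pairing \<epsilon> n (f i)) (m i)) j)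
      \<longlonglongrightarrow> coeff (wick_poly W (\<xi> (f i)) (m i)) j" if "i \<in> {1..N}" for i j
    by (rule wick_poly_coeff_tendsto[OF pM intM pW intW[OF that] lim[OF that]])
  have "(\<integral>\<omega>. (\<Prod>i=1..N. poly (wick_poly W (\<xi> (f i)) (m i)) (\<xi> (f i) \<omega>)) \<partial>W) =
      (\<Sum>k\<in>PiE {1..N} (\<lambda>i. {..m i}). (\<Prod>i=1..N. coeff (wick_poly W (\<xi> (f i)) (m i)) (k i)) *
        (\<integral>\<omega>. (\<Prod>i=1..N. \<xi> (f i) \<omega> ^ k i) \<partial>W))"
    by (rule integral_prod_poly[OF finite_atLeastAtMost degW joint(2)])
  \<comment> \<open>The degree bounds \<open>m i\<close> do not depend on \<open>n\<close>, so the
    expansion has a fixed finite index set and the limit is taken term by term.\<close>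
  then show ?thesis
    unfolding wick_power_def integral_prod_poly[OF finite_atLeastAtMost degM joint(1)]
    by (simp only:) (intro tendsto_sum tendsto_mult tendsto_prod coeff joint(3))
qed

end
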